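(* Let $g,h,r,w,t,d$ be positive integers. Let $\mathcal F=\{(A_1,B_1),\dots,(A_g,B_g)\}$ be a weakly cross-intersecting set-pairs on a ground set of size $h$ such that $|A_i|\le r$ and $|B_i|\le w$ for every $1\le i\le g$. If $t\ge\max\{h,r+w\}$, then $$N((r,w;d),t)\ \ge\ \sum_{i=1}^{g}N((r-|A_i|,\,w-|B_i|;d),\,t-|A_i|-|B_i|).$$
   Context: A family $\{(A_1,B_1),\dots,(A_g,B_g)\}$ is a weakly cross-intersecting set-pairs of size $g$ on a ground set of cardinality $h$ if all $A_i$ and $B_i$ are subsets of a fixed $h$-element set, $A_i\cap B_i=\varnothing$ for every $i$, and $(A_i\cap B_j)\cup(A_j\cap B_i)\ne\varnothing$ for every $i\ne j$. Write $[t]=\{1,\dots,t\}$. For positive integers $r,w,d$, a set system $(X,\mathcal B)$ with $|X|=n$ and an indexed family of blocks $\mathcal B=\{B_1,\dots,B_t\}$ of subsets of $X$ is an $(r,w;d)-CFF(n,t)$ (cover-free family) if for all $L,M\subseteq[t]$ with $L\cap M=\varnothing$, $|L|=r$, $|M|=w$, we have $\left|\left(\bigcap_{l\in L}B_l\right)\setminus\left(\bigcup_{m\in M}B_m\right)\right|\ge d$. $N((r,w;d),t)$ denotes the minimum $n$ for which an $(r,w;d)-CFF(n,t)$ exists. Convention: $N((r,0;d),t)=N((0,w;d),t)=1$ (whenever at least one of the two parameters is $0$). *)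

theory Defs
  imports Main
begin

definition weakly_cross_intersecting ::
    "'a set \<Rightarrow> nat \<Rightarrow> nat \<Rightarrow> (nat \<Rightarrow> 'a set) \<Rightarrow> (nat \<Rightarrow> 'a set) \<Rightarrow> bool" where
  "weakly_cross_intersecting H h g A B \<longleftrightarrow>
     finite H \<and> card H = h \<and>
     (\<forall>i\<in>{1..g}. A i \<subseteq> H \<and> B i \<subseteq> H \<and> A i \<inter> B i = {}) \<and>
     (\<forall>i\<in>{1..g}. \<forall>j\<in>{1..g}. i \<noteq> j \<longrightarrow> (A i \<inter> B j) \<union> (A j \<inter> B i) \<noteq> {})"

text \<open>
  The blocks are indexed by \<open>{1..t}\<close>, so repetitions are allowed. The definition is meant for
  positive \<open>r\<close>, \<open>w\<close>, \<open>d\<close>; for \<open>r = 0\<close> the empty intersection would be the whole type rather than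
  \<open>X\<close>, but this case is never used.
\<close>

definition is_CFF ::
    "nat \<Rightarrow> nat \<Rightarrow> nat \<Rightarrow> nat \<Rightarrow> nat \<Rightarrow> 'a set \<Rightarrow> (nat \<Rightarrow> 'a set) \<Rightarrow> bool" where
  "is_CFF r w d n t X B \<longleftrightarrow>
     finite X \<and> card X = n \<and> (\<forall>i\<in>{1..t}. B i \<subseteq> X) \<and>
     (\<forall>L M. L \<subseteq> {1..t} \<and> M \<subseteq> {1..t} \<and> L \<inter> M = {} \<and> card L = r \<and> card M = w \<longrightarrow>
        d \<le> card ((\<Inter>l\<in>L. B l) - (\<Union>m\<in>M. B m)))"

text \<open>
  The points are taken to be natural numbers; by \<open>is_CFF_transfer\<close> below this does not affect which
  \<open>n\<close> are admissible. By \<open>CFF_exists\<close> the minimum is attained.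
\<close>

definition CFF_N :: "nat \<Rightarrow> nat \<Rightarrow> nat \<Rightarrow> nat \<Rightarrow> nat" where
  "CFF_N r w d t =
     (if r = 0 \<or> w = 0 then 1
      else (LEAST n. \<exists>(X :: nat set) B. is_CFF r w d n t X B))"

lemma is_CFF_transfer:
  fixes X :: "'a set" and Y :: "'b set"
  assumes cff: "is_CFF r w d n t X B" and "0 < r" and Y: "finite Y" "card Y = n"
  shows "\<exists>B'. is_CFF r w d n t Y B'"
proof -
  have X: "finite X" "card X = n" and sub: "\<And>i. i \<in> {1..t} \<Longrightarrow> B i \<subseteq> X"
    using cff by (auto simp: is_CFF_def)
  obtain f where f: "bij_betw f X Y"
    using finite_same_card_bij[OF X(1) Y(1)] X Y by auto
  then have inj: "inj_on f X" and im: "f ` X = Y"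
    by (auto simp: bij_betw_def)
  have "d \<le> card ((\<Inter>l\<in>L. f ` B l) - (\<Union>m\<in>M. f ` B m))"
    if LM: "L \<subseteq> {1..t}" "M \<subseteq> {1..t}" "L \<inter> M = {}" "card L = r" "card M = w" for L M
  proof -
    let ?D = "(\<Inter>l\<in>L. B l) - (\<Union>m\<in>M. B m)"
    have "L \<noteq> {}" using LM(4) \<open>0 < r\<close> by auto
    then obtain l0 where l0: "l0 \<in> L" by auto
    have B_X: "B i \<subseteq> X" if "i \<in> L \<union> M" for i
      by (rule sub) (use that LM(1,2) in blast)
    have DX: "?D \<subseteq> X" using l0 B_X[of l0] by auto
    have "f ` ?D \<subseteq> (\<Inter>l\<in>L. f ` B l) - (\<Union>m\<in>M. f ` B m)"
    proof
      fix y assume "y \<in> f ` ?D"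
      then obtain x where x: "x \<in> ?D" "y = f x" by blast
      have "y \<notin> f ` B m" if m: "m \<in> M" for m
      proof
        assume "y \<in> f ` B m"
        then obtain z where z: "z \<in> B m" "f z = f x" using x by auto
        have "z \<in> X" using B_X[of m] m z(1) by auto
        moreover have "x \<in> X" using DX x(1) by (rule subsetD)
        ultimately have "z = x" by (rule inj_onD[OF inj z(2)])
        then show False using x(1) z(1) m by auto
      qed
      moreover have "y \<in> (\<Inter>l\<in>L. f ` B l)" using x by auto
      ultimately show "y \<in> (\<Inter>l\<in>L. f ` B l) - (\<Union>m\<in>M. f ` B m)" by simp
    qed
    moreover have "finite ((\<Inter>l\<in>L. f ` B l) - (\<Union>m\<in>M. f ` B m))"
    proof (rule finite_subset[OF _ Y(1)])
      show "(\<Inter>l\<in>L. f ` B l) - (\<Union>m\<in>M. f ` B m) \<subseteq> Y"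
      proof -
        have "B l0 \<subseteq> X" using B_X l0 by auto
        then have "f ` B l0 \<subseteq> Y" using im by auto
        then show ?thesis using l0 by auto
      qed
    qed
    ultimately have "card (f ` ?D) \<le> card ((\<Inter>l\<in>L. f ` B l) - (\<Union>m\<in>M. f ` B m))"
      by (rule card_mono[rotated])
    moreover have "card (f ` ?D) = card ?D"
      by (rule card_image[OF inj_on_subset[OF inj DX]])
    moreover have "d \<le> card ?D"
      using cff LM by (auto simp: is_CFF_def)
    ultimately show ?thesis by linarith
  qed
  moreover have "f ` B i \<subseteq> Y" if "i \<in> {1..t}" for i
    using image_mono[OF sub[OF that], of f] im by simp
  ultimately have "is_CFF r w d n t Y (\<lambda>i. f ` B i)"
    using Y by (simp add: is_CFF_def)
  then show ?thesis by blast
qed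

lemma CFF_exists:
  assumes "0 < r"
  shows "\<exists>n (X :: nat set) B. is_CFF r w d n t X B"
proof -
  define X where "X = Pow {1..t} \<times> {..<d}"
  define B where "B = (\<lambda>i. {p \<in> X. i \<in> fst p})"
  have fin: "finite X" by (simp add: X_def)
  have "d \<le> card ((\<Inter>l\<in>L. B l) - (\<Union>m\<in>M. B m))"
    if LM: "L \<subseteq> {1..t}" "L \<inter> M = {}" "card L = r" for L M
  proof -
    have "L \<noteq> {}" using LM(3) assms by auto
    then have "(\<Inter>l\<in>L. B l) - (\<Union>m\<in>M. B m) \<subseteq> X" by (auto simp: B_def)
    then have "finite ((\<Inter>l\<in>L. B l) - (\<Union>m\<in>M. B m))" using fin by (rule finite_subset)
    moreover have "{L} \<times> {..<d} \<subseteq> (\<Inter>l\<in>L. B l) - (\<Union>m\<in>M. B m)"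
      using LM by (auto simp: B_def X_def)
    ultimately have "card ({L} \<times> {..<d}) \<le> card ((\<Inter>l\<in>L. B l) - (\<Union>m\<in>M. B m))"
      by (rule card_mono)
    then show ?thesis by simp
  qed
  then have "is_CFF r w d (card X) t X B"
    using fin by (auto simp: is_CFF_def B_def)
  then have "\<exists>B'. is_CFF r w d (card X) t {..<card X} B'"
    by (rule is_CFF_transfer) (use assms in auto)
  then show ?thesis by blast
qed

end

theory Submission
  imports Defs
begin

text \<open>
  Take an optimal cover-free family and place the ground set of the set-pairs injectively among its
  \<open>t\<close> block indices, which is possible because \<open>h \<le> t\<close>. Each pair \<open>(P, Q)\<close> of disjoint index sets cuts
  out a cell of the point set: the points lying in every block of \<open>P\<close> and in no block of \<open>Q\<close>. An index
  in \<open>A\<^sub>i \<inter> B\<^sub>j\<close> is a block that contains cell \<open>i\<close> and avoids cell \<open>j\<close>, so weak cross-intersection is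
  what makes the cells of different pairs disjoint, and their sizes add up to at most the
  number of points.

  It remains to bound each cell from below. Requiring a point to lie in \<open>r - card P\<close> further blocks and
  to avoid \<open>w - card Q\<close> further blocks, among the \<open>t - card P - card Q\<close> unused ones, is together with
  membership in the cell a single \<open>(r, w)\<close> condition on the original family. Hence the unused blocks,
  restricted to the cell, again form a cover-free family (\<open>is_CFF_cell\<close>). When one of the reduced
  parameters vanishes, the convention \<open>N = 1\<close> only asks for a nonempty cell, and this follows by
  enlarging \<open>P\<close> and \<open>Q\<close> to disjoint sets of sizes \<open>r\<close> and \<open>w\<close> (\<open>cell_nonempty\<close>); the room for that is
  \<open>r + w \<le> t\<close>.
\<close>

definition cell :: "'a set \<Rightarrow> ('i \<Rightarrow> 'a set) \<Rightarrow> 'i set \<Rightarrow> 'i set \<Rightarrow> 'a set" where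
  "cell X B P Q = {x \<in> X. (\<forall>l\<in>P. x \<in> B l) \<and> (\<forall>m\<in>Q. x \<notin> B m)}"

lemma cell_subset: "cell X B P Q \<subseteq> X"
  by (auto simp: cell_def)

lemma cell_disjoint:
  assumes "(P \<inter> Q') \<union> (P' \<inter> Q) \<noteq> {}"
  shows "cell X B P Q \<inter> cell X B P' Q' = {}"
  using assms by (auto simp: cell_def)

lemma CFF_N_attained:
  assumes "0 < r" and "0 < w"
  obtains X :: "nat set" and B where "is_CFF r w d (CFF_N r w d t) t X B"
proof -
  have "\<exists>(X :: nat set) B. is_CFF r w d (LEAST n. \<exists>(X :: nat set) B. is_CFF r w d n t X B) t X B"
    using CFF_exists[OF assms(1)] by (rule LeastI_ex)
  then show ?thesis using that assms by (auto simp: CFF_N_def)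
qed

lemma CFF_N_le:
  assumes "is_CFF r w d n t X B" and "0 < r" and "0 < w"
  shows "CFF_N r w d t \<le> n"
proof -
  have "\<exists>B'. is_CFF r w d n t {..<n} B'"
    by (rule is_CFF_transfer[OF assms(1,2)]) auto
  then have "\<exists>(X :: nat set) B. is_CFF r w d n t X B" by blast
  then have "(LEAST n. \<exists>(X :: nat set) B. is_CFF r w d n t X B) \<le> n"
    by (rule Least_le)
  then show ?thesis using assms by (simp add: CFF_N_def)
qed

lemma is_CFF_card_cell_ge:
  assumes cff: "is_CFF r w d n t X B" and "0 < r"
    and LM: "L \<subseteq> {1..t}" "M \<subseteq> {1..t}" "L \<inter> M = {}" "card L = r" "card M = w"
  shows "d \<le> card (cell X B L M)"
proof -
  have "L \<noteq> {}" using LM(4) \<open>0 < r\<close> by auto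
  moreover have "B l \<subseteq> X" if "l \<in> L" for l
    using cff LM(1) that by (auto simp: is_CFF_def)
  ultimately have "(\<Inter>l\<in>L. B l) - (\<Union>m\<in>M. B m) = cell X B L M"
    by (fastforce simp: cell_def)
  moreover have "d \<le> card ((\<Inter>l\<in>L. B l) - (\<Union>m\<in>M. B m))"
    using cff LM by (simp add: is_CFF_def)
  ultimately show ?thesis by simp
qed

text \<open>
  A cell shrinks as its index sets grow, so it inherits a point from the cell of any full-size
  enlargement of \<open>P\<close> and \<open>Q\<close>.
\<close>

lemma cell_nonempty:
  assumes cff: "is_CFF r w d n t X B" and "0 < r" and "0 < d" and "r + w \<le> t"
    and PQ: "P \<subseteq> {1..t}" "Q \<subseteq> {1..t}" "P \<inter> Q = {}" "card P \<le> r" "card Q \<le> w"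
  shows "cell X B P Q \<noteq> {}"
proof -
  have "card ({1..t} - Q) = t - card Q"
    using PQ(2) by (simp add: card_Diff_subset finite_subset)
  then have "r \<le> card ({1..t} - Q)" using assms(4) PQ(5) by simp
  moreover have "P \<subseteq> {1..t} - Q" using PQ by auto
  ultimately obtain L where L: "P \<subseteq> L" "L \<subseteq> {1..t} - Q" "card L = r"
    using exists_subset_between[of P r "{1..t} - Q"] PQ(4) by auto
  have "L \<subseteq> {1..t}" using L(2) by auto
  then have "card ({1..t} - L) = t - r"
    using L(3) by (simp add: card_Diff_subset finite_subset)
  then have "w \<le> card ({1..t} - L)" using assms(4) by simp
  moreover have "Q \<subseteq> {1..t} - L" using L(2) PQ by auto
  ultimately obtain M where M: "Q \<subseteq> M" "M \<subseteq> {1..t} - L" "card M = w"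
    using exists_subset_between[of Q w "{1..t} - L"] PQ(5) by auto
  have "d \<le> card (cell X B L M)"
    by (rule is_CFF_card_cell_ge[OF cff \<open>0 < r\<close>]) (use \<open>L \<subseteq> {1..t}\<close> L M in auto)
  then have "cell X B L M \<noteq> {}" using \<open>0 < d\<close> by auto
  moreover have "cell X B L M \<subseteq> cell X B P Q"
    using L(1) M(1) by (auto simp: cell_def)
  ultimately show ?thesis by auto
qed

text \<open>
  The blocks outside \<open>P \<union> Q\<close>, renumbered and cut down to the cell, inherit the cover-free property: a
  test \<open>(L, M)\<close> on them has the same witnesses as the test \<open>(P \<union> L, Q \<union> M)\<close> on the original family.
\<close>

lemma is_CFF_cell:
  assumes cff: "is_CFF r w d n t X B"
    and PQ: "P \<subseteq> {1..t}" "Q \<subseteq> {1..t}" "P \<inter> Q = {}" "card P < r" "card Q \<le> w"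
  shows "\<exists>B'. is_CFF (r - card P) (w - card Q) d (card (cell X B P Q)) (t - card P - card Q)
    (cell X B P Q) B'"
proof -
  let ?Y = "cell X B P Q" and ?s = "t - card P - card Q"
  have fin: "finite P" "finite Q" using PQ(1,2) finite_subset by blast+
  have "card ({1..t} - (P \<union> Q)) = ?s"
    using PQ fin by (simp add: card_Diff_subset card_Un_disjoint)
  then obtain e where e: "bij_betw e {1..?s} ({1..t} - (P \<union> Q))"
    using finite_same_card_bij[of "{1..?s}" "{1..t} - (P \<union> Q)"] by auto
  have inj: "inj_on e {1..?s}" and im: "e ` {1..?s} = {1..t} - (P \<union> Q)"
    using e by (auto simp: bij_betw_def)
  have "d \<le> card ((\<Inter>l\<in>L. B (e l) \<inter> ?Y) - (\<Union>m\<in>M. B (e m) \<inter> ?Y))"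
    if LM: "L \<subseteq> {1..?s}" "M \<subseteq> {1..?s}" "L \<inter> M = {}" "card L = r - card P" "card M = w - card Q"
    for L M
  proof -
    have finLM: "finite L" "finite M" using LM(1,2) finite_subset by blast+
    have eL: "e ` L \<subseteq> {1..t} - (P \<union> Q)" and eM: "e ` M \<subseteq> {1..t} - (P \<union> Q)"
      using LM(1,2) im by blast+
    have eLM: "e ` L \<inter> e ` M = {}"
      using inj_on_image_Int[OF inj LM(1,2)] LM(3) by simp
    have "card (P \<union> e ` L) = card P + card (e ` L)"
      by (rule card_Un_disjoint) (use fin finLM eL in auto)
    moreover have "card (e ` L) = r - card P"
      using card_image[OF inj_on_subset[OF inj LM(1)]] LM(4) by simp
    ultimately have cL: "card (P \<union> e ` L) = r" using PQ(4) by simp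
    have "card (Q \<union> e ` M) = card Q + card (e ` M)"
      by (rule card_Un_disjoint) (use fin finLM eM in auto)
    moreover have "card (e ` M) = w - card Q"
      using card_image[OF inj_on_subset[OF inj LM(2)]] LM(5) by simp
    ultimately have cM: "card (Q \<union> e ` M) = w" using PQ(5) by simp
    have "d \<le> card (cell X B (P \<union> e ` L) (Q \<union> e ` M))"
    proof (rule is_CFF_card_cell_ge[OF cff _ _ _ _ cL cM])
      show "0 < r" using PQ(4) by simp
      show "P \<union> e ` L \<subseteq> {1..t}" "Q \<union> e ` M \<subseteq> {1..t}" using PQ eL eM by auto
      show "(P \<union> e ` L) \<inter> (Q \<union> e ` M) = {}" using PQ(3) eL eM eLM by blast
    qed
    (* L has an element because card P < r; an empty intersection would not confine
       the points to the cell. *)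
    moreover have "cell X B (P \<union> e ` L) (Q \<union> e ` M)
        = (\<Inter>l\<in>L. B (e l) \<inter> ?Y) - (\<Union>m\<in>M. B (e m) \<inter> ?Y)"
    proof -
      have "L \<noteq> {}" using LM(4) PQ(4) by auto
      then show ?thesis by (auto simp: cell_def)
    qed
    ultimately show ?thesis by simp
  qed
  moreover have "finite ?Y"
    by (rule finite_subset[OF cell_subset]) (use cff in \<open>simp add: is_CFF_def\<close>)
  ultimately have "is_CFF (r - card P) (w - card Q) d (card ?Y) ?s ?Y (\<lambda>i. B (e i) \<inter> ?Y)"
    by (simp add: is_CFF_def)
  then show ?thesis by blast
qed

lemma CFF_N_le_card_cell:
  assumes cff: "is_CFF r w d n t X B" and "0 < r" and "0 < d" and "r + w \<le> t"
    and PQ: "P \<subseteq> {1..t}" "Q \<subseteq> {1..t}" "P \<inter> Q = {}" "card P \<le> r" "card Q \<le> w"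
  shows "CFF_N (r - card P) (w - card Q) d (t - card P - card Q) \<le> card (cell X B P Q)"
proof (cases "card P < r \<and> card Q < w")
  case True
  then obtain B' where "is_CFF (r - card P) (w - card Q) d (card (cell X B P Q))
      (t - card P - card Q) (cell X B P Q) B'"
    using is_CFF_cell[OF cff PQ(1-3)] by auto
  then show ?thesis by (rule CFF_N_le) (use True in auto)
next
  case False
  have "finite (cell X B P Q)"
    by (rule finite_subset[OF cell_subset]) (use cff in \<open>simp add: is_CFF_def\<close>)
  then have "1 \<le> card (cell X B P Q)"
    using cell_nonempty[OF assms] by (simp add: Suc_le_eq card_gt_0_iff)
  then show ?thesis using False PQ(4,5) by (auto simp: CFF_N_def)
qed

theorem theorem2:
  fixes g h r w t d :: nat
    and H :: "'a set" and A B :: "nat \<Rightarrow> 'a set"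
  assumes "0 < g" and "0 < h" and "0 < r" and "0 < w" and "0 < t" and "0 < d"
    and "weakly_cross_intersecting H h g A B"
    and "\<And>i. i \<in> {1..g} \<Longrightarrow> card (A i) \<le> r \<and> card (B i) \<le> w"
    and "t \<ge> max h (r + w)"
  shows "CFF_N r w d t \<ge>
    (\<Sum>i=1..g. CFF_N (r - card (A i)) (w - card (B i)) d (t - card (A i) - card (B i)))"
proof -
  have t: "h \<le> t" "r + w \<le> t"
    using max.boundedE[OF assms(9)] by blast+
  have H: "finite H" "card H = h"
    and AB: "\<And>i. i \<in> {1..g} \<Longrightarrow> A i \<subseteq> H \<and> B i \<subseteq> H \<and> A i \<inter> B i = {}"
    and cross: "\<And>i j. \<lbrakk>i \<in> {1..g}; j \<in> {1..g}; i \<noteq> j\<rbrakk> \<Longrightarrow> (A i \<inter> B j) \<union> (A j \<inter> B i) \<noteq> {}"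
    using assms(7) unfolding weakly_cross_intersecting_def by blast+
  obtain X :: "nat set" and C where cff: "is_CFF r w d (CFF_N r w d t) t X C"
    by (rule CFF_N_attained[OF \<open>0 < r\<close> \<open>0 < w\<close>])
  then have X: "finite X" "card X = CFF_N r w d t" by (auto simp: is_CFF_def)
  obtain f where f: "f ` H \<subseteq> {1..t}" "inj_on f H"
    using card_le_inj[of H "{1..t}"] H t(1) by auto
  define Y where "Y i = cell X C (f ` A i) (f ` B i)" for i
  have "CFF_N (r - card (A i)) (w - card (B i)) d (t - card (A i) - card (B i)) \<le> card (Y i)"
    if i: "i \<in> {1..g}" for i
  proof -
    have sub: "A i \<subseteq> H" "B i \<subseteq> H" and disj: "A i \<inter> B i = {}" using AB[OF i] by auto
    have cards: "card (f ` A i) = card (A i)" "card (f ` B i) = card (B i)"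
      by (rule card_image[OF inj_on_subset[OF f(2)]], rule sub)+
    have "CFF_N (r - card (f ` A i)) (w - card (f ` B i)) d
        (t - card (f ` A i) - card (f ` B i)) \<le> card (Y i)"
      unfolding Y_def
    proof (rule CFF_N_le_card_cell[OF cff \<open>0 < r\<close> \<open>0 < d\<close>])
      show "r + w \<le> t" by (rule t(2))
      show "f ` A i \<subseteq> {1..t}" "f ` B i \<subseteq> {1..t}" using sub f(1) by blast+
      show "f ` A i \<inter> f ` B i = {}"
        using inj_on_image_Int[OF f(2) sub] disj by simp
      show "card (f ` A i) \<le> r" "card (f ` B i) \<le> w" unfolding cards using assms(8)[OF i] by blast+
    qed
    then show ?thesis unfolding cards .
  qed
  then have "(\<Sum>i=1..g. CFF_N (r - card (A i)) (w - card (B i)) d (t - card (A i) - card (B i)))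
      \<le> (\<Sum>i=1..g. card (Y i))"
    by (rule sum_mono)
  also have "\<dots> = card (\<Union>i\<in>{1..g}. Y i)"
  proof (rule card_UN_disjoint[symmetric])
    show "\<forall>i\<in>{1..g}. finite (Y i)"
      unfolding Y_def using finite_subset[OF cell_subset X(1)] by blast
    show "\<forall>i\<in>{1..g}. \<forall>j\<in>{1..g}. i \<noteq> j \<longrightarrow> Y i \<inter> Y j = {}"
    proof (intro ballI impI)
      fix i j assume "i \<in> {1..g}" "j \<in> {1..g}" "i \<noteq> j"
      then have "(f ` A i \<inter> f ` B j) \<union> (f ` A j \<inter> f ` B i) \<noteq> {}"
        using cross[of i j] by blast
      then show "Y i \<inter> Y j = {}" unfolding Y_def by (rule cell_disjoint)
    qed
  qed simp
  also have "\<dots> \<le> card X"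
  proof (rule card_mono[OF X(1)])
    show "(\<Union>i\<in>{1..g}. Y i) \<subseteq> X" by (auto simp: Y_def cell_def)
  qed
  finally show ?thesis unfolding X(2) .
qed

end
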